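(* Consider an $(\mathsf H,\mathsf r,\mathsf M,\mathsf N)$ combination network with end-user caches, with $\mathsf K:=\binom{\mathsf H}{\mathsf r}$ users. If $$\mathsf M\in\left[\frac{(\mathsf K-\mathsf H+\mathsf r-1)\mathsf N}{\mathsf K},\ \mathsf N\right],$$ then the optimal max-link load is $$\mathsf R^\star=\frac{1-\mathsf M/\mathsf N}{\mathsf r}.$$
   Context: Combination network. Let $\mathsf H,\mathsf r,\mathsf N$ be positive integers with $\mathsf r\le \mathsf H$, and let $\mathsf M\in[0,\mathsf N]$. A server has $\mathsf N$ independent files $F_1,\ldots,F_{\mathsf N}$, each consisting of $\mathsf B$ i.i.d. uniformly distributed bits. The server is connected to $\mathsf H$ relays (without caches) through $\mathsf H$ error-free orthogonal links. There are $\mathsf K=\binom{\mathsf H}{\mathsf r}$ users; each user is connected to a distinct subset of exactly $\mathsf r$ relays through $\mathsf r$ error-free orthogonal links, and has a cache of $\mathsf M\mathsf B$ bits. $\mathcal H_k\subseteq[\mathsf H]$ (with $|\mathcal H_k|=\mathsf r$) denotes the set of relays connected to user $k$, and $\mathcal U_h\subseteq[\mathsf K]$ denotes the set of users connected to relay $h$. Placement phase: user $k$ stores a cache content $Z_k$ of at most $\mathsf M\mathsf B$ bits, a function of $(F_1,\ldots,F_{\mathsf N})$ chosen without knowledge of the demands; $\mathbf Z=(Z_1,\ldots,Z_{\mathsf K})$. Coded placement (arbitrary functions of the files) is allowed. Delivery phase: user $k$ requests file $d_k\in[\mathsf N]$, and the demand vector $\mathbf d=(d_1,\ldots,d_{\mathsf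 K})$ is revealed to all nodes. Given $(\mathbf d,\mathbf Z)$, the server sends to each relay $h$ a message $X_h$ of $\mathsf B\,\mathsf R_h(\mathbf d,\mathbf Z)$ bits (a function of the files, $\mathbf d$ and $\mathbf Z$). Relay $h$ then sends to each user $k\in\mathcal U_h$ a message $X_{h\to k}$ of $\mathsf B\,\mathsf R_{h\to k}(\mathbf d,\mathbf Z)$ bits, a function of $X_h$ given the (known) demand vector and placement. User $k$ must recover $F_{d_k}$ from $Z_k$ and $(X_{h\to k}:h\in\mathcal H_k)$ with probability tending to $1$ as $\mathsf B\to\infty$. The max-link load of a scheme is $\max_{\mathbf d\in[\mathsf N]^{\mathsf K}}\max_{h\in[\mathsf H],\,k\in\mathcal U_h}\max\{\mathsf R_h(\mathbf d,\mathbf Z),\mathsf R_{h\to k}(\mathbf d,\mathbf Z)\}$ (asymptotically as $\mathsf B\to\infty$). The optimal max-link load $\mathsf R^\star=\mathsf R^\star(\mathsf M)$ is the minimum (infimum) of the max-link load over all placements $\mathbf Z$ with cache size $\mathsf M$ and all delivery schemes meeting the decoding requirement. *)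

theory Defs
  imports "HOL-Probability.Probability"
begin

type_synonym bits = "bool list"
type_synonym files = "nat \<Rightarrow> bits"
type_synonym demand = "nat \<Rightarrow> nat"

text \<open>
  Relays are \<open>1..H\<close>, users \<open>1..K\<close>, files \<open>1..N\<close>; \<open>\<H> k\<close> is the set of relays connected
  to user \<open>k\<close>, and \<open>users_of K \<H> h\<close> is the set of users connected to relay \<open>h\<close>.
\<close>

definition combination_topology :: "nat \<Rightarrow> nat \<Rightarrow> nat \<Rightarrow> (nat \<Rightarrow> nat set) \<Rightarrow> bool" where
  "combination_topology H r K \<H> \<longleftrightarrow>
     K = H choose r \<and> inj_on \<H> {1..K} \<and> (\<forall>k\<in>{1..K}. \<H> k \<subseteq> {1..H} \<and> card (\<H> k) = r)"

definition users_of :: "nat \<Rightarrow> (nat \<Rightarrow> nat set) \<Rightarrow> nat \<Rightarrow> nat set" where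
  "users_of K \<H> h = {k \<in> {1..K}. h \<in> \<H> k}"

definition demands :: "nat \<Rightarrow> nat \<Rightarrow> demand set" where
  "demands K N = {1..K} \<rightarrow>\<^sub>E {1..N}"

definition file_pmf :: "nat \<Rightarrow> nat \<Rightarrow> files pmf" where
  "file_pmf N B = Pi_pmf {1..N} [] (\<lambda>_. replicate_pmf B (pmf_of_set UNIV))"

lemma set_file_pmf:
  "set_pmf (file_pmf N B) = PiE_dflt {1..N} [] (\<lambda>_. {xs. length xs = B})"
  by (simp add: file_pmf_def set_Pi_pmf set_replicate_pmf comp_def)

text \<open>
  A code for one fixed file length. A placement and a delivery scheme are chosen together; the
  placement functions take no demand. The server message is a function of the files and the
  demand only, because the placement functions are part of the code and the cache contents are
  themselves functions of the files; for the same reason the relays need no further argument.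
  The message lengths (in bits) may depend on the demand but not on the realization of the files.
\<close>

record code =
  cache :: "nat \<Rightarrow> files \<Rightarrow> bits"
  server_msg :: "demand \<Rightarrow> nat \<Rightarrow> files \<Rightarrow> bits"
  server_len :: "demand \<Rightarrow> nat \<Rightarrow> nat"
  relay_msg :: "demand \<Rightarrow> nat \<Rightarrow> nat \<Rightarrow> bits \<Rightarrow> bits"
  relay_len :: "demand \<Rightarrow> nat \<Rightarrow> nat \<Rightarrow> nat"
  decode :: "demand \<Rightarrow> nat \<Rightarrow> bits \<Rightarrow> (nat \<Rightarrow> bits) \<Rightarrow> bits"

definition valid_code ::
  "nat \<Rightarrow> nat \<Rightarrow> nat \<Rightarrow> real \<Rightarrow> (nat \<Rightarrow> nat set) \<Rightarrow> nat \<Rightarrow> code \<Rightarrow> bool" where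
  "valid_code H K N M \<H> B c \<longleftrightarrow>
     (\<forall>F \<in> set_pmf (file_pmf N B).
        (\<forall>k\<in>{1..K}. real (length (cache c k F)) \<le> M * real B) \<and>
        (\<forall>d\<in>demands K N. \<forall>h\<in>{1..H}.
           length (server_msg c d h F) = server_len c d h \<and>
           (\<forall>k\<in>users_of K \<H> h.
              length (relay_msg c d h k (server_msg c d h F)) = relay_len c d h k)))"

text \<open>The decoder of user \<open>k\<close> only sees its cache and the messages of the relays in \<open>\<H> k\<close>.\<close>

definition recovered :: "(nat \<Rightarrow> nat set) \<Rightarrow> code \<Rightarrow> demand \<Rightarrow> nat \<Rightarrow> files \<Rightarrow> bits" where
  "recovered \<H> c d k F =
     decode c d k (cache c k F) (\<lambda>h\<in>\<H> k. relay_msg c d h k (server_msg c d h F))"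

definition success_prob ::
  "nat \<Rightarrow> (nat \<Rightarrow> nat set) \<Rightarrow> nat \<Rightarrow> code \<Rightarrow> demand \<Rightarrow> nat \<Rightarrow> real" where
  "success_prob N \<H> B c d k =
     measure_pmf.prob (file_pmf N B) {F. recovered \<H> c d k F = F (d k)}"

definition max_link_load ::
  "nat \<Rightarrow> nat \<Rightarrow> nat \<Rightarrow> (nat \<Rightarrow> nat set) \<Rightarrow> nat \<Rightarrow> code \<Rightarrow> real" where
  "max_link_load H K N \<H> B c =
     (MAX d\<in>demands K N. MAX h\<in>{1..H}. MAX k\<in>users_of K \<H> h.
        max (real (server_len c d h) / real B) (real (relay_len c d h k) / real B))"

text \<open>A scheme is a family of codes, one for each file length.\<close>

definition schemes ::
  "nat \<Rightarrow> nat \<Rightarrow> nat \<Rightarrow> real \<Rightarrow> (nat \<Rightarrow> nat set) \<Rightarrow> (nat \<Rightarrow> code) set" where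
  "schemes H K N M \<H> =
     {s. (\<forall>B>0. valid_code H K N M \<H> B (s B)) \<and>
         (\<forall>d\<in>demands K N. \<forall>k\<in>{1..K}. (\<lambda>B. success_prob N \<H> B (s B) d k) \<longlonglongrightarrow> 1)}"

definition optimal_max_link_load ::
  "nat \<Rightarrow> nat \<Rightarrow> nat \<Rightarrow> real \<Rightarrow> (nat \<Rightarrow> nat set) \<Rightarrow> ereal" where
  "optimal_max_link_load H K N M \<H> =
     (INF s\<in>schemes H K N M \<H>. limsup (\<lambda>B. ereal (max_link_load H K N \<H> B (s B))))"

end

theory Submission
  imports Defs
begin

text \<open>
  Converse: one user must be able to recover all \<open>N\<close> files from its cache and the messages it
  receives under the \<open>N\<close> constant demands, so \<open>M B + N r R B\<close> bits must distinguish, up to a constant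
  factor, \<open>2 ^ (N B)\<close> file tuples.

  Achievability: at the smallest cache size in the range, split every file into blocks indexed by the
  \<open>(r - 1)\<close>-subsets \<open>A\<close> of the relays, where user \<open>k\<close> stores block \<open>A\<close> of all files unless
  \<open>A \<subseteq> \<H> k\<close>. Relay \<open>h\<close> broadcasts the XOR, over its users \<open>k\<close>, of block \<open>\<H> k - {h}\<close> of file \<open>d k\<close>.
  Every summand other than that of \<open>k\<close> is stored by \<open>k\<close>, because \<open>\<H> j - {h} \<subseteq> \<H> k\<close> with \<open>h\<close> in both
  sets forces \<open>\<H> j = \<H> k\<close>. Larger caches are obtained by shrinking the blocks and storing the
  remaining bits everywhere.
\<close>

section \<open>Counting bit strings and the uniform law of the files\<close>

lemma finite_bits_length [simp]: "finite {xs :: bits. length xs = B}"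
  using finite_lists_length_eq[of "UNIV :: bool set" B] by simp

lemma card_bits_length [simp]: "card {xs :: bits. length xs = B} = 2 ^ B"
  using card_lists_length_eq[of "UNIV :: bool set" B] by simp

lemma replicate_pmf_uniform:
  "replicate_pmf B (pmf_of_set (UNIV :: bool set)) = pmf_of_set {xs. length xs = B}"
proof (rule pmf_eqI)
  fix xs :: "bool list"
  have "pmf (replicate_pmf B (pmf_of_set (UNIV :: bool set))) xs
      = (if length xs = B then (1 / 2) ^ B else 0)"
  proof (induction B arbitrary: xs)
    case (Suc B)
    \<comment> \<open>Presenting the law as the image of a product law under the injective map
      \<open>#\<close> makes the mass of \<open>y # ys\<close> a product, which drives the
      induction.\<close>
    have "replicate_pmf (Suc B) (pmf_of_set (UNIV :: bool set))
        = map_pmf (\<lambda>(x, xs). x # xs) (pair_pmf (pmf_of_set UNIV) (replicate_pmf B (pmf_of_set UNIV)))"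
      by (simp add: pair_pmf_def map_bind_pmf)
    moreover have "inj (\<lambda>(x :: bool, xs). x # xs)"
      by (auto simp: inj_def)
    ultimately have step: "pmf (replicate_pmf (Suc B) (pmf_of_set UNIV)) (y # ys)
        = pmf (pmf_of_set UNIV) y * pmf (replicate_pmf B (pmf_of_set UNIV)) ys" for y :: bool and ys
      using pmf_map_inj'[of "\<lambda>(x :: bool, xs). x # xs" _ "(y, ys)"] by (simp add: pmf_pair)
    show ?case
    proof (cases xs)
      case Nil
      then show ?thesis
        by (simp add: pmf_eq_0_set_pmf set_replicate_pmf del: replicate_pmf.simps)
    next
      case (Cons y ys)
      then show ?thesis
        by (simp add: step Suc.IH del: replicate_pmf.simps)
    qed
  qed simp
  moreover have "{xs :: bits. length xs = B} \<noteq> {}"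
    using Ex_list_of_length by blast
  ultimately show "pmf (replicate_pmf B (pmf_of_set (UNIV :: bool set))) xs
      = pmf (pmf_of_set {xs. length xs = B}) xs"
    by (simp add: pmf_of_set power_one_over)
qed

text \<open>Turns probabilities over the files into ratios of cardinalities, as the counting in the
  converse requires.\<close>

lemma file_pmf_uniform: "file_pmf N B = pmf_of_set (set_pmf (file_pmf N B))"
proof -
  have "{xs :: bits. length xs = B} \<noteq> {}"
    using Ex_list_of_length by blast
  then show ?thesis
    unfolding set_file_pmf by (simp add: file_pmf_def replicate_pmf_uniform Pi_pmf_of_set)
qed

lemma finite_set_file_pmf: "finite (set_pmf (file_pmf N B))"
  by (auto simp: set_file_pmf)

lemma card_set_file_pmf: "card (set_pmf (file_pmf N B)) = 2 ^ (N * B)"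
  by (simp add: set_file_pmf card_PiE_dflt mult.commute flip: power_mult)

text \<open>A cache has only an upper bound on its length, so all shorter strings count as well; the
  geometric sum costs at most one extra bit.\<close>

lemma card_bits_length_le: "card {xs :: bits. length xs \<le> m} \<le> 2 ^ (m + 1)"
proof -
  have "card {xs :: bits. length xs \<le> m} = (\<Sum>i\<le>m. 2 ^ i)"
    using card_lists_length_le[of "UNIV :: bool set" m] by simp
  also have "\<dots> \<le> 2 ^ (m + 1)"
    by (induction m) auto
  finally show ?thesis .
qed

text \<open>Decoding of an XOR, written as the parity of a cardinality: once all summands but one
  are known, the parity determines the last.\<close>

lemma odd_card_cancel:
  assumes "finite U" "k \<in> U" "\<And>j. j \<in> U \<Longrightarrow> j \<noteq> k \<Longrightarrow> P j \<longleftrightarrow> Q j"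
    and "odd (card {j \<in> U. P j}) \<longleftrightarrow> odd (card {j \<in> U. Q j})"
  shows "P k \<longleftrightarrow> Q k"
proof -
  have split: "card {j \<in> U. R j} = card {j \<in> U - {k}. R j} + (if R k then 1 else 0)" for R
  proof (cases "R k")
    case True
    then have "{j \<in> U. R j} = insert k {j \<in> U - {k}. R j}"
      using assms(2) by auto
    then show ?thesis
      using True assms(1) by simp
  next
    case False
    then have "{j \<in> U. R j} = {j \<in> U - {k}. R j}"
      by auto
    then show ?thesis
      using False by simp
  qed
  have "{j \<in> U - {k}. P j} = {j \<in> U - {k}. Q j}"
    using assms(3) by auto
  then show ?thesis
    using assms(4) split[of P] split[of Q] by (auto split: if_splits)
qed

section \<open>Converse at a fixed file length\<close>

text \<open>With error at most \<open>1 / (2 * real N)\<close> per demand, the union bound over the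
  \<open>N\<close> constant demands leaves at least half of the file tuples decoded correctly under
  all of them. On these, the cache and the received messages of user \<open>k\<close> determine the
  whole tuple.\<close>

lemma single_user_converse:
  assumes valid: "valid_code H K N M \<H> B c"
    and k: "k \<in> {1..K}" "\<H> k \<subseteq> {1..H}" "card (\<H> k) = r"
    and "0 \<le> M" "1 \<le> N"
    and len: "\<And>d h. d \<in> demands K N \<Longrightarrow> h \<in> \<H> k \<Longrightarrow> real (relay_len c d h k) \<le> \<rho>"
    and succ: "\<And>d. d \<in> demands K N \<Longrightarrow> success_prob N \<H> B c d k \<ge> 1 - 1 / (2 * real N)"
  shows "(real N - M) * real B - 2 \<le> real N * real r * \<rho>"
proof -
  define S where "S = set_pmf (file_pmf N B)"
  define D where "D i = (\<lambda>j\<in>{1..K}. i)" for i :: nat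
  define m where "m = nat \<lfloor>M * real B\<rfloor>"
  define msg where "msg F = (\<lambda>(i, h)\<in>{1..N} \<times> \<H> k. relay_msg c (D i) h k (server_msg c (D i) h F))" for F
  define G where "G = {F \<in> S. \<forall>i\<in>{1..N}. recovered \<H> c (D i) k F = F i}"
  define T where "T = {z :: bits. length z \<le> m} \<times>
    (\<Pi>\<^sub>E p \<in> {1..N} \<times> \<H> k. {xs :: bits. length xs = relay_len c (D (fst p)) (snd p) k})"
  have D: "D i \<in> demands K N" if "i \<in> {1..N}" for i
    using that by (auto simp: D_def demands_def)
  have Dk: "D i k = i" for i
    using k by (simp add: D_def)
  have finH: "finite (\<H> k)"
    using k finite_subset by blast
  have finS: "finite S"
    by (simp add: S_def finite_set_file_pmf)
  have finT: "finite T"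
    using finH finite_lists_length_le[of "UNIV :: bool set" m]
    by (auto simp: T_def intro!: finite_PiE)

  have "measure_pmf.prob (file_pmf N B) (- G) \<le> 1 / 2"
  proof -
    have "measure_pmf.prob (file_pmf N B) (- G)
        = measure_pmf.prob (file_pmf N B) (- G \<inter> S)"
      unfolding S_def by (simp add: measure_Int_set_pmf)
    also have "\<dots> \<le> measure_pmf.prob (file_pmf N B)
        (\<Union>i\<in>{1..N}. - {F. recovered \<H> c (D i) k F = F (D i k)})"
      by (rule measure_pmf.finite_measure_mono) (auto simp: G_def Dk)
    also have "\<dots> \<le> (\<Sum>i\<in>{1..N}. measure_pmf.prob (file_pmf N B)
        (- {F. recovered \<H> c (D i) k F = F (D i k)}))"
      by (rule measure_pmf.finite_measure_subadditive_finite) auto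
    also have "\<dots> \<le> (\<Sum>i\<in>{1..N}. 1 / (2 * real N))"
    proof (rule sum_mono)
      fix i assume "i \<in> {1..N}"
      then show "measure_pmf.prob (file_pmf N B) (- {F. recovered \<H> c (D i) k F = F (D i k)})
          \<le> 1 / (2 * real N)"
        using succ[OF D, of i] measure_pmf.prob_compl[of "{F. recovered \<H> c (D i) k F = F (D i k)}" "file_pmf N B"]
        by (simp add: success_prob_def Compl_eq_Diff_UNIV)
    qed
    also have "\<dots> = 1 / 2"
      using \<open>1 \<le> N\<close> by simp
    finally show ?thesis .
  qed
  then have "1 / 2 \<le> measure_pmf.prob (file_pmf N B) G"
    using measure_pmf.prob_compl[of G "file_pmf N B"] by (simp add: Compl_eq_Diff_UNIV)
  also have "\<dots> = real (card G) / 2 ^ (N * B)"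
  proof -
    have "S \<noteq> {}" "S \<inter> G = G"
      by (auto simp: S_def G_def set_pmf_not_empty)
    then show ?thesis
      using measure_pmf_of_set[of S G] finS card_set_file_pmf[of N B] file_pmf_uniform[of N B]
      by (simp add: S_def)
  qed
  finally have "2 ^ (N * B) \<le> 2 * real (card G)"
    by (simp add: field_simps)

  moreover have "card G \<le> card T"
  proof (rule card_inj_on_le[OF _ _ finT])
    show "inj_on (\<lambda>F. (cache c k F, msg F)) G"
    proof (rule inj_onI, rule ext)
      fix F F' i
      assume F: "F \<in> G" and F': "F' \<in> G" and eq: "(cache c k F, msg F) = (cache c k F', msg F')"
      show "F i = F' i"
      proof (cases "i \<in> {1..N}")
        case True
        have "relay_msg c (D i) h k (server_msg c (D i) h F)
            = relay_msg c (D i) h k (server_msg c (D i) h F')" if "h \<in> \<H> k" for h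
        proof -
          have "msg F (i, h) = msg F' (i, h)"
            using eq by simp
          then show ?thesis
            using that True by (simp add: msg_def)
        qed
        then have "recovered \<H> c (D i) k F = recovered \<H> c (D i) k F'"
          using eq by (simp add: recovered_def cong: restrict_cong)
        then show ?thesis
          using F F' True by (simp add: G_def)
      next
        \<comment> \<open>Outside \<open>{1..N}\<close> every tuple in the support has the default
          value \<open>[]\<close>.\<close>
        case False
        then show ?thesis
          using F F' by (auto simp: G_def S_def set_file_pmf PiE_dflt_def)
      qed
    qed
    show "(\<lambda>F. (cache c k F, msg F)) ` G \<subseteq> T"
    proof (rule image_subsetI)
      fix F assume "F \<in> G"
      then have F: "F \<in> set_pmf (file_pmf N B)"
        by (simp add: G_def S_def)
      have "real (length (cache c k F)) \<le> M * real B"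
        using valid F k by (auto simp: valid_code_def)
      then have "length (cache c k F) \<le> m"
        unfolding m_def by linarith
      moreover have "length (relay_msg c (D i) h k (server_msg c (D i) h F)) = relay_len c (D i) h k"
        if "i \<in> {1..N}" "h \<in> \<H> k" for i h
      proof -
        have "h \<in> {1..H}" "k \<in> users_of K \<H> h"
          using that k by (auto simp: users_of_def)
        then show ?thesis
          using valid F D[OF that(1)] unfolding valid_code_def by blast
      qed
      ultimately show "(cache c k F, msg F) \<in> T"
        by (auto simp: T_def msg_def)
    qed
  qed
  moreover have "card T \<le> 2 ^ (m + 1) * 2 ^ (\<Sum>p\<in>{1..N} \<times> \<H> k. relay_len c (D (fst p)) (snd p) k)"
    using card_bits_length_le[of m] finH
    by (simp add: T_def card_cartesian_product card_PiE power_sum)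
  ultimately have "2 ^ (N * B) \<le> 2 * real (2 ^ (m + 1) * 2 ^ (\<Sum>p\<in>{1..N} \<times> \<H> k. relay_len c (D (fst p)) (snd p) k))"
    by (smt (verit) of_nat_mono)
  \<comment> \<open>Of the two extra bits, one pays for the half of the tuples that may be lost, the
    other for cache contents shorter than \<open>m\<close>.\<close>
  also have "\<dots> = 2 ^ (m + 2 + (\<Sum>p\<in>{1..N} \<times> \<H> k. relay_len c (D (fst p)) (snd p) k))"
    by (simp add: power_add)
  finally have "N * B \<le> m + 2 + (\<Sum>p\<in>{1..N} \<times> \<H> k. relay_len c (D (fst p)) (snd p) k)"
    by (simp only: of_nat_numeral power_increasing_iff[of "2 :: real"] one_less_numeral_iff semiring_norm)
  then have "real (N * B) \<le> real m + 2 + (\<Sum>p\<in>{1..N} \<times> \<H> k. real (relay_len c (D (fst p)) (snd p) k))"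
    by (metis (mono_tags, lifting) of_nat_add of_nat_mono of_nat_numeral of_nat_sum sum.cong)
  moreover have "real m \<le> M * real B"
    using \<open>0 \<le> M\<close> by (simp add: m_def)
  moreover have "(\<Sum>p\<in>{1..N} \<times> \<H> k. real (relay_len c (D (fst p)) (snd p) k))
      \<le> (\<Sum>p\<in>{1..N} \<times> \<H> k. \<rho>)"
    using len D by (intro sum_mono) auto
  ultimately show ?thesis
    using k(3) by (simp add: algebra_simps card_cartesian_product)
qed

section \<open>Achievability at a fixed file length\<close>

lemma map_product_eq_iff:
  "map f (List.product xs ys) = map g (List.product xs ys)
    \<longleftrightarrow> (\<forall>x\<in>set xs. \<forall>y\<in>set ys. f (x, y) = g (x, y))"
  by auto

text \<open>
  The \<open>e\<close> bits after the blocks are stored nowhere and sent in the clear; they absorb the rounding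
  of \<open>L\<close>, so that the cache constraint holds exactly for every \<open>B\<close>.
\<close>
lemma ex_achievable_code:
  assumes "1 \<le> r" "r \<le> H" and topo: "combination_topology H r K \<H>"
    and fits: "(H choose (r - 1)) * L + e \<le> B"
  shows "\<exists>c. (\<forall>k\<in>{1..K}. \<forall>F. length (cache c k F) = N * (B - (r * L + e))) \<and>
     (\<forall>d h F. length (server_msg c d h F) = L + K * e) \<and>
     (\<forall>d h. server_len c d h = L + K * e) \<and>
     (\<forall>d h k x. relay_msg c d h k x = x) \<and>
     (\<forall>d h k. relay_len c d h k = L + K * e) \<and>
     (\<forall>d\<in>demands K N. \<forall>k\<in>{1..K}. \<forall>F\<in>set_pmf (file_pmf N B). recovered \<H> c d k F = F (d k))"
proof -
  define n where "n = H choose (r - 1)"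
  define S where "S = set_pmf (file_pmf N B)"
  have inj: "inj_on \<H> {1..K}" and sub: "\<And>k. k \<in> {1..K} \<Longrightarrow> \<H> k \<subseteq> {1..H}"
    and card: "\<And>k. k \<in> {1..K} \<Longrightarrow> card (\<H> k) = r"
    using topo by (auto simp: combination_topology_def)
  have fin: "finite (\<H> k)" if "k \<in> {1..K}" for k
    using sub[OF that] finite_subset by blast
  define \<A> where "\<A> = {A. A \<subseteq> {1..H} \<and> card A = r - 1}"
  have "finite \<A>" "card \<A> = n"
    using n_subsets[of "{1..H}" "r - 1"] by (simp_all add: \<A>_def n_def)
  then obtain blk where blk: "bij_betw blk \<A> {0..<n}"
    using ex_bij_betw_finite_nat by metis
  have in_\<A>: "\<H> k - {h} \<in> \<A>" if "k \<in> {1..K}" "h \<in> \<H> k" for k h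
    using that sub[OF that(1)] card[OF that(1)] fin[OF that(1)] by (auto simp: \<A>_def)
  \<comment> \<open>Block \<open>A\<close> occupies the \<open>L\<close> positions from
    \<open>blk A * L\<close> on; \<open>pos k h q\<close> is bit \<open>q\<close> of the block that
    user \<open>k\<close> obtains through relay \<open>h\<close>.\<close>
  define pos where "pos k h q = blk (\<H> k - {h}) * L + q" for k h q
  have blk_lt: "blk A < n" if "A \<in> \<A>" for A
    using blk that by (auto simp: bij_betw_def)
  have pos_lt: "pos k h q < n * L" if "k \<in> {1..K}" "h \<in> \<H> k" "q < L" for k h q
  proof -
    have "pos k h q < (blk (\<H> k - {h}) + 1) * L"
      using that(3) by (simp add: pos_def)
    also have "\<dots> \<le> n * L"
      using blk_lt[OF in_\<A>[OF that(1,2)]] by (intro mult_right_mono) auto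
    finally show ?thesis .
  qed
  \<comment> \<open>Several users may need the same block, so a position reveals only the relay
    subset and the offset, read off by \<open>div\<close> and \<open>mod\<close>.\<close>
  have pos_eq: "\<H> k - {h} = \<H> k' - {h'} \<and> q = q'"
    if "k \<in> {1..K}" "h \<in> \<H> k" "q < L" "k' \<in> {1..K}" "h' \<in> \<H> k'" "q' < L"
      and eq: "pos k h q = pos k' h' q'" for k h q k' h' q'
  proof -
    have "pos k h q div L = blk (\<H> k - {h})" "pos k h q mod L = q"
      "pos k' h' q' div L = blk (\<H> k' - {h'})" "pos k' h' q' mod L = q'"
      using that(3,6) by (simp_all add: pos_def)
    then have "blk (\<H> k - {h}) = blk (\<H> k' - {h'})" "q = q'"
      using eq by auto
    then show ?thesis
      using blk in_\<A> that by (meson bij_betw_def inj_on_def)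
  qed
  \<comment> \<open>The sets \<open>\<H> k - {h}\<close> with \<open>h \<in> \<H> k\<close> are
    exactly the \<open>(r - 1)\<close>-subsets of \<open>\<H> k\<close>. The interval is the
    unstored tail.\<close>
  define missing where
    "missing k = (\<lambda>(h, q). pos k h q) ` (\<H> k \<times> {0..<L}) \<union> {n * L..<n * L + e}" for k
  define stored where "stored k = {0..<B} - missing k" for k
  have card_stored: "card (stored k) = B - (r * L + e)" if k: "k \<in> {1..K}" for k
  proof -
    have inj_pos: "inj_on (\<lambda>(h, q). pos k h q) (\<H> k \<times> {0..<L})"
    proof (rule inj_onI, clarify)
      fix h q h' q'
      assume *: "h \<in> \<H> k" "q \<in> {0..<L}" "h' \<in> \<H> k" "q' \<in> {0..<L}" "pos k h q = pos k h' q'"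
      then have "\<H> k - {h} = \<H> k - {h'}" "q = q'"
        using pos_eq[of k h q k h' q'] k by auto
      with * show "h = h' \<and> q = q'"
        by blast
    qed
    have "card (missing k) = r * L + e"
      unfolding missing_def using k fin[OF k] pos_lt[OF k]
      by (subst card_Un_disjoint)
        (fastforce simp: card_image[OF inj_pos] card_cartesian_product card[OF k])+
    moreover have "missing k \<subseteq> {0..<B}"
      using fits pos_lt[OF k] by (fastforce simp: missing_def n_def)
    ultimately show ?thesis
      unfolding stored_def by (simp add: card_Diff_subset finite_subset)
  qed

  define z where "z k F = map (\<lambda>(i, p). F i ! p)
    (List.product [1..<N + 1] (sorted_list_of_set (stored k)))" for k and F :: files
  \<comment> \<open>The first \<open>L\<close> bits are the XORs, as parities. Then come, in every
    relay message, the tails of the files requested by all \<open>K\<close> users.\<close>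
  define X where "X d h F =
    map (\<lambda>q. odd (card {j \<in> users_of K \<H> h. F (d j) ! pos j h q})) [0..<L] @
    map (\<lambda>(j, p). F (d j) ! p) (List.product [1..<K + 1] [n * L..<n * L + e])"
    for d :: demand and h and F :: files
  \<comment> \<open>Any file tuple consistent with what user \<open>k\<close> sees will do, by \<open>determined\<close> below.\<close>
  define dec where "dec d k y x =
    (SOME F. F \<in> S \<and> z k F = y \<and> (\<lambda>h\<in>\<H> k. X d h F) = x) (d k)" for d k y x
  define c where "c = \<lparr>cache = z, server_msg = X, server_len = (\<lambda>d h. L + K * e),
    relay_msg = (\<lambda>d h k x. x), relay_len = (\<lambda>d h k. L + K * e), decode = dec\<rparr>"

  have determined: "F (d k) = F' (d k)"
    if F: "F \<in> S" "F' \<in> S" and d: "d \<in> demands K N" and k: "k \<in> {1..K}"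
      and zeq: "z k F = z k F'" and Xeq: "\<And>h. h \<in> \<H> k \<Longrightarrow> X d h F = X d h F'"
    for F F' d k
  proof (rule nth_equalityI)
    have dk: "d j \<in> {1..N}" if "j \<in> {1..K}" for j
      using d that by (auto simp: demands_def)
    have len: "length (F (d k)) = B" "length (F' (d k)) = B"
      using F dk[OF k] by (auto simp: S_def set_file_pmf PiE_dflt_def)
    then show "length (F (d k)) = length (F' (d k))"
      by simp
    have fin_stored: "finite (stored k)"
      by (simp add: stored_def)
    have agree: "F i ! p = F' i ! p" if "i \<in> {1..N}" "p \<in> stored k" for i p
    proof -
      have "\<forall>i\<in>set [1..<N + 1]. \<forall>p\<in>set (sorted_list_of_set (stored k)). F i ! p = F' i ! p"
        using zeq by (simp only: z_def map_product_eq_iff prod.case)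
      moreover have "i \<in> set [1..<N + 1]" "p \<in> set (sorted_list_of_set (stored k))"
        using that fin_stored by auto
      ultimately show ?thesis
        by blast
    qed
    have agree_rest: "F (d k) ! p = F' (d k) ! p" if "p \<in> {n * L..<n * L + e}" for p
    proof -
      \<comment> \<open>Any single relay suffices for the tail, and \<open>1 \<le> r\<close>
        provides one.\<close>
      obtain h where h: "h \<in> \<H> k"
        using card[OF k] \<open>1 \<le> r\<close> by fastforce
      have "map (\<lambda>(j, p). F (d j) ! p) (List.product [1..<K + 1] [n * L..<n * L + e])
          = map (\<lambda>(j, p). F' (d j) ! p) (List.product [1..<K + 1] [n * L..<n * L + e])"
        using Xeq[OF h] by (simp add: X_def del: upt_Suc)
      then have "\<forall>j\<in>set [1..<K + 1]. \<forall>p\<in>set [n * L..<n * L + e]. F (d j) ! p = F' (d j) ! p"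
        by (simp only: map_product_eq_iff prod.case)
      moreover have "k \<in> set [1..<K + 1]" "p \<in> set [n * L..<n * L + e]"
        using that k by auto
      ultimately show ?thesis
        by blast
    qed
    have agree_pos: "F (d k) ! pos k h q = F' (d k) ! pos k h q" if h: "h \<in> \<H> k" and q: "q < L" for h q
    proof (rule odd_card_cancel[where U = "users_of K \<H> h" and k = k
          and P = "\<lambda>j. F (d j) ! pos j h q" and Q = "\<lambda>j. F' (d j) ! pos j h q"])
      show "finite (users_of K \<H> h)" "k \<in> users_of K \<H> h"
        using k h by (auto simp: users_of_def)
      show "odd (card {j \<in> users_of K \<H> h. F (d j) ! pos j h q}) =
          odd (card {j \<in> users_of K \<H> h. F' (d j) ! pos j h q})"
        using Xeq[OF h] q by (simp add: X_def)
      fix j assume "j \<in> users_of K \<H> h" "j \<noteq> k"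
      then have j: "j \<in> {1..K}" "h \<in> \<H> j"
        by (auto simp: users_of_def)
      have "pos j h q \<notin> missing k"
      proof
        assume "pos j h q \<in> missing k"
        then obtain h' q' where *: "h' \<in> \<H> k" "q' < L" "pos j h q = pos k h' q'"
          using pos_lt[OF j q] by (auto simp: missing_def)
        then have "\<H> j - {h} = \<H> k - {h'}"
          using pos_eq[of j h q k h' q'] j k q by blast
        \<comment> \<open>As \<open>h\<close> lies in \<open>\<H> k\<close> but not in
          \<open>\<H> j - {h}\<close>, necessarily \<open>h' = h\<close>; adding \<open>h\<close>
          back on both sides gives the equality.\<close>
        then have "\<H> j = \<H> k"
          using j h * by blast
        then show False
          using inj j k \<open>j \<noteq> k\<close> by (meson inj_onD)
      qed
      then have "pos j h q \<in> stored k"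
        using pos_lt[OF j q] fits by (simp add: stored_def n_def)
      then show "F (d j) ! pos j h q = F' (d j) ! pos j h q"
        using agree dk[OF j(1)] by blast
    qed
    \<comment> \<open>Each position is stored, or in the tail, or some \<open>pos k h q\<close>; the
      three agreement facts cover these cases.\<close>
    fix p assume "p < length (F (d k))"
    then show "F (d k) ! p = F' (d k) ! p"
      using agree[OF dk[OF k]] agree_rest agree_pos len
      by (cases "p \<in> missing k") (auto simp: stored_def missing_def)
  qed
  have recovered: "recovered \<H> c d k F = F (d k)"
    if d: "d \<in> demands K N" and k: "k \<in> {1..K}" and F: "F \<in> S" for d k F
  proof -
    define F' where "F' = (SOME F'. F' \<in> S \<and> z k F' = z k F \<and> (\<lambda>h\<in>\<H> k. X d h F') = (\<lambda>h\<in>\<H> k. X d h F))"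
    have F': "F' \<in> S \<and> z k F' = z k F \<and> (\<lambda>h\<in>\<H> k. X d h F') = (\<lambda>h\<in>\<H> k. X d h F)"
      unfolding F'_def by (rule someI[of _ F]) (simp add: F)
    then have "X d h F' = X d h F" if "h \<in> \<H> k" for h
      using that by (metis restrict_apply')
    then have "F' (d k) = F (d k)"
      using determined[of F' F d k] F' F d k by blast
    then show ?thesis
      by (simp add: recovered_def c_def dec_def F'_def)
  qed
  show ?thesis
    by (rule exI[of _ c], intro conjI ballI allI)
      (simp_all add: c_def z_def X_def card_stored length_product recovered[unfolded c_def S_def])
qed

section \<open>Evaluating the max-link load\<close>

text \<open>By cardinality the injection \<open>\<H>\<close> hits every \<open>r\<close>-subset of
  the relays, in particular one containing \<open>h\<close>. This keeps the inner \<open>MAX\<close>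
  of the load from ranging over an empty set.\<close>

lemma users_of_nonempty:
  assumes "1 \<le> r" "r \<le> H" and topo: "combination_topology H r K \<H>" and h: "h \<in> {1..H}"
  shows "users_of K \<H> h \<noteq> {}"
proof -
  have "\<H> ` {1..K} = {A. A \<subseteq> {1..H} \<and> card A = r}"
  proof (rule card_subset_eq)
    show "finite {A. A \<subseteq> {1..H} \<and> card A = r}"
      by simp
    show "\<H> ` {1..K} \<subseteq> {A. A \<subseteq> {1..H} \<and> card A = r}"
      using topo by (auto simp: combination_topology_def)
    have "card (\<H> ` {1..K}) = H choose r"
      using topo card_image[of \<H> "{1..K}"] by (auto simp: combination_topology_def simp del: One_nat_def)
    then show "card (\<H> ` {1..K}) = card {A. A \<subseteq> {1..H} \<and> card A = r}"
      using n_subsets[of "{1..H}" r] by simp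
  qed
  moreover have "r - 1 \<le> card ({1..H} - {h})"
    using h \<open>r \<le> H\<close> by simp
  then obtain T where T: "T \<subseteq> {1..H} - {h}" "card T = r - 1" "finite T"
    by (rule obtain_subset_with_card_n)
  then have "insert h T \<subseteq> {1..H}" "h \<notin> T"
    using h by auto
  then have "insert h T \<subseteq> {1..H}" "card (insert h T) = r"
    using T \<open>1 \<le> r\<close> by auto
  ultimately obtain k where "k \<in> {1..K}" "\<H> k = insert h T"
    by (metis (mono_tags, lifting) imageE mem_Collect_eq)
  then show ?thesis
    by (auto simp: users_of_def)
qed

lemma demands_finite_nonempty:
  assumes "1 \<le> N"
  shows "finite (demands K N)" "demands K N \<noteq> {}"
  using assms by (auto simp: demands_def PiE_eq_empty_iff intro!: finite_PiE)

lemma relay_len_le_max_link_load: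
  assumes "1 \<le> N" "0 < B" "d \<in> demands K N" "h \<in> {1..H}" "k \<in> users_of K \<H> h"
  shows "real (relay_len c d h k) \<le> max_link_load H K N \<H> B c * real B"
proof -
  let ?g = "\<lambda>d h k. max (real (server_len c d h) / real B) (real (relay_len c d h k) / real B)"
  have "real (relay_len c d h k) / real B \<le> ?g d h k"
    by simp
  also have "\<dots> \<le> (MAX k\<in>users_of K \<H> h. ?g d h k)"
    using assms by (intro Max_ge) (auto simp: users_of_def)
  also have "\<dots> \<le> (MAX h\<in>{1..H}. MAX k\<in>users_of K \<H> h. ?g d h k)"
    using assms by (intro Max_ge) auto
  also have "\<dots> \<le> max_link_load H K N \<H> B c"
    unfolding max_link_load_def using assms demands_finite_nonempty(1)[OF \<open>1 \<le> N\<close>, of K]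
    by (intro Max_ge) auto
  finally show ?thesis
    using \<open>0 < B\<close> by (simp add: field_simps)
qed

lemma Max_image_const:
  assumes "A \<noteq> {}" "\<And>a. a \<in> A \<Longrightarrow> f a = y"
  shows "Max (f ` A) = y"
proof -
  have "f ` A = {y}"
    using assms by auto
  then show ?thesis
    by simp
qed

lemma max_link_load_const:
  assumes "1 \<le> N" "1 \<le> H" "\<And>h. h \<in> {1..H} \<Longrightarrow> users_of K \<H> h \<noteq> {}"
    and "\<And>d h. server_len c d h = l" "\<And>d h k. relay_len c d h k = l"
  shows "max_link_load H K N \<H> B c = real l / real B"
  unfolding max_link_load_def
  by (intro Max_image_const demands_finite_nonempty) (use assms in auto)

section \<open>Passing to the limit in the file length\<close>

text \<open>There are finitely many demands, so user 1 eventually meets the error threshold of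
  \<open>single_user_converse\<close> for all of them at once. Dividing its bound by
  \<open>N r B\<close> turns the loss of two bits into a term that vanishes.\<close>

lemma limsup_load_ge:
  assumes "1 \<le> r" "r \<le> H" "1 \<le> N" "0 \<le> M" and topo: "combination_topology H r K \<H>"
    and s: "s \<in> schemes H K N M \<H>"
  shows "ereal ((1 - M / real N) / real r) \<le> limsup (\<lambda>B. ereal (max_link_load H K N \<H> B (s B)))"
proof -
  define x where "x = (1 - M / real N) / real r"
  have "1 \<le> K"
    using topo \<open>r \<le> H\<close> by (simp add: combination_topology_def Suc_le_eq)
  then have k: "1 \<in> {1..K}" "\<H> 1 \<subseteq> {1..H}" "card (\<H> 1) = r"
    using topo by (auto simp: combination_topology_def)
  have "\<forall>\<^sub>F B in sequentially. \<forall>d\<in>demands K N. success_prob N \<H> B (s B) d 1 > 1 - 1 / (2 * real N)"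
  proof (subst eventually_ball_finite_distrib)
    show "finite (demands K N)"
      using demands_finite_nonempty \<open>1 \<le> N\<close> by blast
    show "\<forall>d\<in>demands K N. \<forall>\<^sub>F B in sequentially. success_prob N \<H> B (s B) d 1 > 1 - 1 / (2 * real N)"
      using s k(1) \<open>1 \<le> N\<close> by (auto simp: schemes_def intro!: order_tendstoD(1)[where y = 1])
  qed
  then have "\<forall>\<^sub>F B in sequentially. ereal (x - 2 / (real N * real r) / real B)
      \<le> ereal (max_link_load H K N \<H> B (s B))"
    using eventually_gt_at_top[of 0]
  proof eventually_elim
    case (elim B)
    have "(real N - M) * real B - 2
        \<le> real N * real r * (max_link_load H K N \<H> B (s B) * real B)"
    proof (rule single_user_converse)
      show "valid_code H K N M \<H> B (s B)"
        using s elim by (simp add: schemes_def)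
      show "real (relay_len (s B) d h 1) \<le> max_link_load H K N \<H> B (s B) * real B"
        if "d \<in> demands K N" "h \<in> \<H> 1" for d h
        using that k elim \<open>1 \<le> N\<close>
        by (intro relay_len_le_max_link_load) (auto simp: users_of_def)
    qed (use k elim assms in \<open>auto intro: less_imp_le\<close>)
    moreover have "(real N - M) * real B - 2
        = real N * real r * real B * (x - 2 / (real N * real r) / real B)"
      using assms elim by (simp add: x_def field_simps)
    moreover have "0 < real N * real r * real B"
      using assms elim by simp
    ultimately have "x - 2 / (real N * real r) / real B \<le> max_link_load H K N \<H> B (s B)"
      by (smt (verit) mult.assoc mult.commute mult_less_cancel_left_pos)
    then show ?case
      by simp
  qed
  then have "limsup (\<lambda>B. ereal (x - 2 / (real N * real r) / real B))
      \<le> limsup (\<lambda>B. ereal (max_link_load H K N \<H> B (s B)))"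
    by (rule Limsup_mono)
  moreover have "(\<lambda>B. x - 2 / (real N * real r) / real B) \<longlonglongrightarrow> x - 0"
    by (intro tendsto_intros lim_const_over_n)
  then have "limsup (\<lambda>B. ereal (x - 2 / (real N * real r) / real B)) = ereal x"
    by (intro lim_imp_Limsup) simp_all
  ultimately show ?thesis
    by (simp add: x_def)
qed

text \<open>Blocks of about \<open>x * real B\<close> bits give the load \<open>x\<close>, up to at
  most \<open>K r\<close> bits of tails per link, which vanish after division by
  \<open>B\<close>.\<close>

lemma ex_scheme_limsup_load_le:
  assumes "1 \<le> r" "r \<le> H" "1 \<le> N" and topo: "combination_topology H r K \<H>"
    and M: "(real K - real H + real r - 1) * real N / real K \<le> M" "M \<le> real N"
  shows "\<exists>s\<in>schemes H K N M \<H>.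
    limsup (\<lambda>B. ereal (max_link_load H K N \<H> B (s B))) \<le> ereal ((1 - M / real N) / real r)"
proof -
  define x where "x = (1 - M / real N) / real r"
  define n where "n = H choose (r - 1)"
  define L where "L B = nat \<lfloor>x * real B\<rfloor>" for B
  \<comment> \<open>User \<open>k\<close> must leave out at least \<open>r x B\<close> bits of each
    file, and its \<open>r\<close> blocks fall short of that by less than \<open>r\<close> bits
    because of the floor. A tail of \<open>r\<close> bits makes up for this, if that much room is
    left.\<close>
  define e where "e B = min r (B - n * L B)" for B
  have "0 \<le> x"
    using assms by (simp add: x_def)
  have L: "real (L B) \<le> x * real B" "x * real B < real (L B) + 1" for B
    using \<open>0 \<le> x\<close> by (auto simp: L_def)
  have K: "K = H choose r"
    using topo by (simp add: combination_topology_def)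
  then have "0 < K"
    using \<open>r \<le> H\<close> by simp
  have "r * K = (H - (r - 1)) * n"
    using binomial_absorb_comp[of H "r - 1"] times_binomial_minus1_eq[of r H] \<open>1 \<le> r\<close> \<open>r \<le> H\<close>
    by (simp add: K n_def)
  then have "real r * real K = real (H - (r - 1)) * real n"
    by (metis of_nat_mult)
  also have "real (H - (r - 1)) = real H - real r + 1"
    using \<open>1 \<le> r\<close> \<open>r \<le> H\<close> by linarith
  finally have rK: "real r * real K = (real H - real r + 1) * real n" .
  \<comment> \<open>The \<open>n\<close> blocks of length \<open>x * real B\<close> fit into a file.
    By \<open>rK\<close>, the smallest \<open>M\<close> of the range is the one with
    \<open>x * real n = 1\<close>.\<close>
  have xn: "x * real n \<le> 1"
  proof -
    have "1 - M / real N \<le> (real H - real r + 1) / real K"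
      using M(1) \<open>1 \<le> N\<close> \<open>0 < K\<close> by (simp add: field_simps)
    then have "x \<le> (real H - real r + 1) / (real r * real K)"
      using divide_right_mono[of "1 - M / real N" "(real H - real r + 1) / real K" "real r"]
      by (simp add: x_def mult.commute)
    then have "x * real n \<le> (real H - real r + 1) * real n / (real r * real K)"
      using mult_right_mono[of x "(real H - real r + 1) / (real r * real K)" "real n"] by simp
    then show ?thesis
      using \<open>0 < K\<close> \<open>1 \<le> r\<close> unfolding rK[symmetric] by simp
  qed
  have nL: "n * L B \<le> B" for B
  proof -
    have "real n * real (L B) \<le> real n * (x * real B)"
      using L(1) by (intro mult_left_mono) auto
    also have "\<dots> = (x * real n) * real B"
      by simp
    also have "\<dots> \<le> 1 * real B"
      using xn by (intro mult_right_mono) auto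
    finally have "real (n * L B) \<le> real B"
      by simp
    then show ?thesis
      using of_nat_le_iff by blast
  qed
  have fits: "n * L B + e B \<le> B" for B
    using nL[of B] by (simp add: e_def)
  have "r \<le> n"
  proof -
    have "Suc (r - 1) choose (r - 1) \<le> n"
      unfolding n_def using assms by (intro binomial_right_mono) simp
    then show ?thesis
      using binomial_Suc_n[of "r - 1"] \<open>1 \<le> r\<close> by simp
  qed
  have cache_size: "real (N * (B - (r * L B + e B))) \<le> M * real B" for B
  proof -
    have le: "r * L B + e B \<le> B"
      using fits[of B] mult_le_mono1[OF \<open>r \<le> n\<close>, of "L B"] by linarith
    have "real (B - (r * L B + e B)) \<le> real B - real r * x * real B"
    proof (cases "e B = r")
      case True
      have "real r * (x * real B) \<le> real r * (real (L B) + 1)"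
        using L(2)[of B] by (intro mult_left_mono) auto
      then show ?thesis
        using le True by (simp add: of_nat_diff algebra_simps)
    next
      \<comment> \<open>Fewer than \<open>r\<close> positions remain after the blocks and the tail
        takes them all. What is stored is then \<open>n - r\<close> whole blocks, and
        \<open>xn\<close> gives the bound.\<close>
      case False
      then have "real (e B) = real B - real n * real (L B)"
        using nL[of B] by (simp add: e_def min_def of_nat_diff split: if_splits)
      then have "real (B - (r * L B + e B)) = (real n - real r) * real (L B)"
        using le by (simp add: of_nat_diff left_diff_distrib)
      also have "\<dots> \<le> (real n - real r) * (x * real B)"
        using L(1) \<open>r \<le> n\<close> by (intro mult_left_mono) auto
      also have "\<dots> = (x * real n) * real B - real r * x * real B"
        by (simp add: algebra_simps)
      also have "\<dots> \<le> 1 * real B - real r * x * real B"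
        using xn by (intro diff_right_mono mult_right_mono) auto
      finally show ?thesis
        by simp
    qed
    then have "real N * real (B - (r * L B + e B)) \<le> real N * (real B - real r * x * real B)"
      by (intro mult_left_mono) auto
    also have "\<dots> = M * real B"
      using assms by (simp add: x_def field_simps)
    finally show ?thesis
      by simp
  qed
  have "\<forall>B. \<exists>c. (\<forall>k\<in>{1..K}. \<forall>F. length (cache c k F) = N * (B - (r * L B + e B))) \<and>
     (\<forall>d h F. length (server_msg c d h F) = L B + K * e B) \<and>
     (\<forall>d h. server_len c d h = L B + K * e B) \<and>
     (\<forall>d h k x. relay_msg c d h k x = x) \<and>
     (\<forall>d h k. relay_len c d h k = L B + K * e B) \<and>
     (\<forall>d\<in>demands K N. \<forall>k\<in>{1..K}. \<forall>F\<in>set_pmf (file_pmf N B). recovered \<H> c d k F = F (d k))"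
    using ex_achievable_code[OF \<open>1 \<le> r\<close> \<open>r \<le> H\<close> topo] fits by (auto simp: n_def)
  then obtain s where s:
    "\<And>B k F. k \<in> {1..K} \<Longrightarrow> length (cache (s B) k F) = N * (B - (r * L B + e B))"
    "\<And>B d h F. length (server_msg (s B) d h F) = L B + K * e B"
    "\<And>B d h. server_len (s B) d h = L B + K * e B"
    "\<And>B d h k x. relay_msg (s B) d h k x = x"
    "\<And>B d h k. relay_len (s B) d h k = L B + K * e B"
    "\<And>B d k F. d \<in> demands K N \<Longrightarrow> k \<in> {1..K} \<Longrightarrow> F \<in> set_pmf (file_pmf N B)
      \<Longrightarrow> recovered \<H> (s B) d k F = F (d k)"
    by metis
  have "success_prob N \<H> B (s B) d k = 1" if "d \<in> demands K N" "k \<in> {1..K}" for B d k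
    unfolding success_prob_def using s(6)[OF that]
    by (intro measure_pmf.prob_eq_1[THEN iffD2]) (auto simp: AE_measure_pmf_iff)
  then have scheme: "s \<in> schemes H K N M \<H>"
    using cache_size s(1-5) by (auto simp: schemes_def valid_code_def)
  have "max_link_load H K N \<H> B (s B) \<le> x + real K * real r / real B" if "0 < B" for B
  proof -
    have "max_link_load H K N \<H> B (s B) = real (L B + K * e B) / real B"
      by (rule max_link_load_const) (use users_of_nonempty assms s in auto)
    also have "\<dots> \<le> (x * real B + real K * real r) / real B"
      using L(1)[of B] by (intro divide_right_mono) (auto simp: e_def intro!: add_mono mult_left_mono)
    also have "\<dots> = x + real K * real r / real B"
      using that by (simp add: field_simps)
    finally show ?thesis .
  qed
  then have "\<forall>\<^sub>F B in sequentially. ereal (max_link_load H K N \<H> B (s B))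
      \<le> ereal (x + real K * real r / real B)"
    by (intro eventually_mono[OF eventually_gt_at_top[of 0]]) simp
  then have "limsup (\<lambda>B. ereal (max_link_load H K N \<H> B (s B)))
      \<le> limsup (\<lambda>B. ereal (x + real K * real r / real B))"
    by (rule Limsup_mono)
  moreover have "(\<lambda>B. x + real K * real r / real B) \<longlonglongrightarrow> x + 0"
    by (intro tendsto_intros lim_const_over_n)
  then have "limsup (\<lambda>B. ereal (x + real K * real r / real B)) = ereal x"
    by (intro lim_imp_Limsup) simp_all
  ultimately show ?thesis
    using scheme by (auto simp: x_def)
qed

theorem theorem2:
  fixes H r N K :: nat and M :: real and \<H> :: "nat \<Rightarrow> nat set"
  assumes "1 \<le> r" and "r \<le> H" and "1 \<le> N"
    and "M \<in> {0..real N}"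
    and "combination_topology H r K \<H>"
    and "M \<in> {(real K - real H + real r - 1) * real N / real K..real N}"
  shows "optimal_max_link_load H K N M \<H> = ereal ((1 - M / real N) / real r)"
proof (rule antisym)
  have M: "(real K - real H + real r - 1) * real N / real K \<le> M" "M \<le> real N"
    using assms(6) by auto
  obtain s where "s \<in> schemes H K N M \<H>"
    "limsup (\<lambda>B. ereal (max_link_load H K N \<H> B (s B))) \<le> ereal ((1 - M / real N) / real r)"
    using ex_scheme_limsup_load_le[OF assms(1-3,5) M] by blast
  then show "optimal_max_link_load H K N M \<H> \<le> ereal ((1 - M / real N) / real r)"
    unfolding optimal_max_link_load_def by (meson INF_lower2)
  show "ereal ((1 - M / real N) / real r) \<le> optimal_max_link_load H K N M \<H>"
    unfolding optimal_max_link_load_def using limsup_load_ge assms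
    by (intro INF_greatest) auto
qed

end
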